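(* For each integer $m\ge 3$, putting $n=(4^m-4)/3$, there is a $4$-ary $(n, 4^{n-m},3)_4$ code which is not a shortened $1$-perfect code and which is an element of a partition of the vertex set of $H(n,4)$ into codes with the same parameters $(n,4^{n-m},3)_4$.
   Context: $H(n,q)$ is the Hamming graph on words of length $n$ over $\{0,1,\ldots,q-1\}$, two words adjacent iff they differ in exactly one position. An $(n,M,d)_q$ code is a set of $M$ words of length $n$ over a $q$-ary alphabet with minimum Hamming distance $d$. A $1$-perfect code in $H(n,q)$ is a set $C$ of vertices such that every vertex is at distance $0$ or $1$ from exactly one element of $C$. A code $S$ of length $n$ is a shortened $P$, for a code $P$ of length $n+1$, if for some position $j$ and symbol $\alpha$, $S$ is obtained by taking the codewords of $P$ having $\alpha$ in position $j$ and deleting position $j$; $S$ is a shortened $1$-perfect code if it is a shortened $P$ for some $1$-perfect code $P$ in $H(n+1,q)$. *)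

theory Defs
  imports Main "HOL-Library.Disjoint_Sets"
begin

definition words :: "nat \<Rightarrow> nat \<Rightarrow> nat list set" where
  "words n q = {x. length x = n \<and> set x \<subseteq> {0..<q}}"

(* Only used for words of equal length. On words n q this is also the path distance of the
   Hamming graph H(n,q), whose edges are the pairs of words at Hamming distance exactly 1. *)
definition hamming_dist :: "nat list \<Rightarrow> nat list \<Rightarrow> nat" where
  "hamming_dist x y = card {i. i < length x \<and> x ! i \<noteq> y ! i}"

(* Codes with fewer than two words get the junk value Inf {} = 0. *)
definition min_dist :: "nat list set \<Rightarrow> nat" where
  "min_dist C = Inf {hamming_dist x y | x y. x \<in> C \<and> y \<in> C \<and> x \<noteq> y}"

(* C is an (n,M,d) code over the q-ary alphabet {0..<q}; the minimum distance is exactly d. *)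
definition is_code :: "nat \<Rightarrow> nat \<Rightarrow> nat \<Rightarrow> nat \<Rightarrow> nat list set \<Rightarrow> bool" where
  "is_code n M d q C \<longleftrightarrow> C \<subseteq> words n q \<and> card C = M \<and> min_dist C = d"

definition one_perfect :: "nat \<Rightarrow> nat \<Rightarrow> nat list set \<Rightarrow> bool" where
  "one_perfect n q C \<longleftrightarrow>
     C \<subseteq> words n q \<and> (\<forall>x\<in>words n q. \<exists>!c. c \<in> C \<and> hamming_dist x c \<in> {0, 1})"

definition delete_pos :: "nat \<Rightarrow> nat list \<Rightarrow> nat list" where
  "delete_pos j w = take j w @ drop (Suc j) w"

definition shortening :: "nat \<Rightarrow> nat \<Rightarrow> nat list set \<Rightarrow> nat list set" where
  "shortening j \<alpha> P = delete_pos j ` {w \<in> P. w ! j = \<alpha>}"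

definition shortened_one_perfect :: "nat \<Rightarrow> nat \<Rightarrow> nat list set \<Rightarrow> bool" where
  "shortened_one_perfect n q S \<longleftrightarrow>
     (\<exists>P j \<alpha>. one_perfect (n + 1) q P \<and> j < n + 1 \<and> \<alpha> < q \<and> S = shortening j \<alpha> P)"

end

theory Submission
  imports Defs "HOL-Computational_Algebra.Polynomial"
begin

text \<open>
  Call a word a hole of a code with distance 3 if it is at distance at least 2 from the code. If the
  code is a shortened 1-perfect code, then reading off the deleted symbol of the codeword covering
  a hole colours the holes with 3 colours such that holes at distance at most 2 get different
  colours.

  Suppose that \<open>H(n,4)\<close> is partitioned into codes labelled by \<open>GF(4)\<^sup>k\<close>, with labelling \<open>F\<close>.
  Put \<open>N = 4\<^sup>k\<close> and index the letters of \<open>y\<close> by \<open>s \<in> GF(4)\<^sup>k\<close>; then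
  \<open>(F x + \<Sum>\<^sub>s y\<^sub>s s, \<Sum>\<^sub>s y\<^sub>s)\<close> labels a partition of \<open>H(n + N, 4)\<close> into codes with distance 3.
  There are \<open>4\<^sup>k\<close> words \<open>y\<close> of zero sum, pairwise at distance at most 2, whose weighted sums
  \<open>\<Sum>\<^sub>s y\<^sub>s s\<close> take all values. Through them, a colouring of the holes of the code labelled \<open>0\<close>
  colours the holes of all the codes of the smaller partition simultaneously, such that a common
  hole of two codes gets two different colours.

  For \<open>k = 2\<close> and \<open>n = 4\<close> there is a partition without such a simultaneous colouring.
\<close>

section \<open>Hamming distance and holes\<close>

lemma hamming_dist_Nil [simp]: "hamming_dist [] y = 0"
  by (simp add: hamming_dist_def)

lemma hamming_dist_Cons [simp]:
  "hamming_dist (a # x) (b # y) = (if a = b then 0 else 1) + hamming_dist x y"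
proof -
  let ?D = "{i. i < length x \<and> x ! i \<noteq> y ! i}"
  have "{i. i < length (a # x) \<and> (a # x) ! i \<noteq> (b # y) ! i}
      = (if a = b then {} else {0}) \<union> Suc ` ?D"
  proof (intro set_eqI)
    fix i
    show "i \<in> {i. i < length (a # x) \<and> (a # x) ! i \<noteq> (b # y) ! i}
      \<longleftrightarrow> i \<in> (if a = b then {} else {0}) \<union> Suc ` ?D"
      by (cases i) auto
  qed
  moreover have "card ((if a = b then {} else {0}) \<union> Suc ` ?D) = (if a = b then 0 else 1) + card ?D"
    by (auto simp: card_image card_insert_if)
  ultimately show ?thesis
    by (simp add: hamming_dist_def)
qed

lemma hamming_dist_append:
  "length x = length x' \<Longrightarrow>
    hamming_dist (x @ y) (x' @ y') = hamming_dist x x' + hamming_dist y y'"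
  by (induction x x' rule: list_induct2) auto

lemma hamming_dist_self [simp]: "hamming_dist x x = 0"
  by (simp add: hamming_dist_def)

lemma hamming_dist_eq_0_iff: "length x = length y \<Longrightarrow> hamming_dist x y = 0 \<longleftrightarrow> x = y"
  by (induction x y rule: list_induct2) auto

lemma hamming_dist_commute: "length x = length y \<Longrightarrow> hamming_dist x y = hamming_dist y x"
  by (induction x y rule: list_induct2) auto

lemma hamming_dist_list_update:
  "hamming_dist x (x[i := a]) \<le> 1"
  by (induction x arbitrary: i) (auto split: nat.split)

lemma hamming_dist_list_update_agree:
  assumes "length x = length y" "i < length x" "x ! i \<noteq> y ! i"
  shows "hamming_dist x y = Suc (hamming_dist (x[i := y ! i]) y)"
  using assms
  by (induction x y arbitrary: i rule: list_induct2) (auto simp: less_Suc_eq_0_disj)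

section \<open>Deleting and inserting a letter\<close>

lemma length_delete_pos [simp]: "j < length w \<Longrightarrow> length (delete_pos j w) = length w - 1"
  by (auto simp: delete_pos_def)

lemma hamming_dist_delete_pos:
  assumes "length x = length y" "j < length x"
  shows "hamming_dist x y = (if x ! j = y ! j then 0 else 1) + hamming_dist (delete_pos j x) (delete_pos j y)"
proof -
  have "hamming_dist (take j x @ x ! j # drop (Suc j) x) (take j y @ y ! j # drop (Suc j) y)
    = (if x ! j = y ! j then 0 else 1) + hamming_dist (delete_pos j x) (delete_pos j y)"
    using assms by (simp add: hamming_dist_append delete_pos_def)
  then show ?thesis
    using assms by (simp flip: id_take_nth_drop)
qed

text \<open>Undoes \<open>delete_pos j\<close> once the lost letter is known; it lifts holes of a
  shortened code to words one letter longer.\<close>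

definition insert_pos :: "nat \<Rightarrow> 'a \<Rightarrow> 'a list \<Rightarrow> 'a list" where
  "insert_pos j a w = take j w @ a # drop j w"

lemma insert_pos_simps [simp]:
  assumes "j \<le> length w"
  shows "length (insert_pos j a w) = Suc (length w)" "insert_pos j a w ! j = a"
    "delete_pos j (insert_pos j a w) = w"
  using assms by (auto simp: insert_pos_def delete_pos_def nth_append)

lemma insert_pos_delete_pos:
  "j < length w \<Longrightarrow> insert_pos j (w ! j) (delete_pos j w) = w"
  by (simp add: insert_pos_def delete_pos_def id_take_nth_drop[symmetric] min_def)

section \<open>Words over the alphabet\<close>

lemma words_lengthD: "w \<in> words n q \<Longrightarrow> length w = n"
  by (simp add: words_def)

lemma words_append_iff:
  "length x = n \<Longrightarrow> x @ y \<in> words (n + N) q \<longleftrightarrow> x \<in> words n q \<and> y \<in> words N q"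
  by (auto simp: words_def)

lemma words_take_drop:
  assumes "w \<in> words (n + N) q"
  shows "take n w \<in> words n q" "drop n w \<in> words N q"
  using assms by (auto simp: words_def dest: in_set_takeD in_set_dropD)

lemma words_insert_pos:
  "w \<in> words n q \<Longrightarrow> a < q \<Longrightarrow> insert_pos j a w \<in> words (n + 1) q"
  by (auto simp: words_def insert_pos_def dest: in_set_takeD in_set_dropD)

lemma words_list_update:
  "w \<in> words n q \<Longrightarrow> a < q \<Longrightarrow> w[i := a] \<in> words n q"
  using set_update_subset_insert[of w i a] by (auto simp: words_def)

lemma words_nth_less: "w \<in> words n q \<Longrightarrow> i < n \<Longrightarrow> w ! i < q"
  by (auto simp: words_def dest: nth_mem)

lemma words_eq_lists: "words n q = {xs. set xs \<subseteq> {0..<q} \<and> length xs = n}"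
  by (auto simp: words_def)

lemma finite_words [simp]: "finite (words n q)"
  unfolding words_eq_lists by (rule finite_lists_length_eq) simp

lemma card_words: "card (words n q) = q ^ n"
  unfolding words_eq_lists by (simp add: card_lists_length_eq)

lemma min_dist_eqI:
  assumes "x \<in> C" "y \<in> C" "x \<noteq> y" "hamming_dist x y = d"
    and "\<And>x y. x \<in> C \<Longrightarrow> y \<in> C \<Longrightarrow> x \<noteq> y \<Longrightarrow> d \<le> hamming_dist x y"
  shows "min_dist C = d"
  unfolding min_dist_def using assms by (intro cInf_eq_minimum) blast+

section \<open>Holes and their colourings\<close>

definition holes :: "nat \<Rightarrow> nat \<Rightarrow> nat list set \<Rightarrow> nat list set" where
  "holes n q C = {w \<in> words n q. \<forall>c\<in>C. 2 \<le> hamming_dist w c}"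

text \<open>The codes of a partition are given as fibres of a labelling \<open>F\<close>, so that
  the partition can be handled by arithmetic on labels.\<close>

definition fibre :: "nat \<Rightarrow> nat \<Rightarrow> (nat list \<Rightarrow> 'b) \<Rightarrow> 'b \<Rightarrow> nat list set" where
  "fibre n q F u = {x \<in> words n q. F x = u}"

text \<open>A colouring of the pairs \<open>(x, u)\<close> with \<open>x\<close> a hole of the code labelled \<open>u\<close> amounts to an
  extension of the partition by one coordinate to a partition into 1-perfect codes.\<close>

definition hole_colouring ::
    "nat \<Rightarrow> nat \<Rightarrow> 'b set \<Rightarrow> (nat list \<Rightarrow> 'b) \<Rightarrow> (nat list \<Rightarrow> 'b \<Rightarrow> nat) \<Rightarrow> nat set \<Rightarrow> bool" where
  "hole_colouring n q L F \<chi> K \<longleftrightarrow>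
     (\<forall>u\<in>L. \<forall>x\<in>holes n q (fibre n q F u). \<chi> x u \<in> K) \<and>
     (\<forall>u\<in>L. \<forall>x\<in>holes n q (fibre n q F u). \<forall>x'\<in>holes n q (fibre n q F u).
        x \<noteq> x' \<and> hamming_dist x x' \<le> 2 \<longrightarrow> \<chi> x u \<noteq> \<chi> x' u) \<and>
     (\<forall>u\<in>L. \<forall>u'\<in>L. \<forall>x\<in>holes n q (fibre n q F u) \<inter> holes n q (fibre n q F u').
        u \<noteq> u' \<longrightarrow> \<chi> x u \<noteq> \<chi> x u')"

text \<open>If two codewords were at distance at most 2, changing one letter of the first towards
  the second would give a word within distance 1 of both.\<close>

lemma one_perfect_dist:
  assumes P: "one_perfect n q P" and c: "c \<in> P" "c' \<in> P" "c \<noteq> c'"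
  shows "3 \<le> hamming_dist c c'"
proof (rule ccontr)
  assume le: "\<not> 3 \<le> hamming_dist c c'"
  have w: "c \<in> words n q" "c' \<in> words n q"
    using P c by (auto simp: one_perfect_def)
  then have len: "length c = n" "length c' = n"
    by (auto simp: words_lengthD)
  then obtain i where i: "i < n" "c ! i \<noteq> c' ! i"
    using c(3) by (metis nth_equalityI)
  define z where "z = c[i := c' ! i]"
  have z: "z \<in> words n q"
    unfolding z_def using w i by (intro words_list_update words_nth_less)
  have "hamming_dist c z \<le> 1"
    unfolding z_def by (rule hamming_dist_list_update)
  moreover have "length z = n"
    using z by (simp add: words_lengthD)
  ultimately have "hamming_dist z c \<in> {0, 1}"
    using len hamming_dist_commute[of c z] by auto
  moreover have "hamming_dist z c' \<in> {0, 1}"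
    using hamming_dist_list_update_agree[of c c' i] len i le unfolding z_def by auto
  ultimately show False
    using P z c by (auto simp: one_perfect_def)
qed

text \<open>A hole with \<open>\<alpha>\<close> inserted is covered by a codeword of
  \<open>P\<close> whose letter at \<open>j\<close> is not \<open>\<alpha>\<close>, since otherwise
  the hole would be within distance 1 of the shortened code. So this codeword is the hole with
  another letter inserted, and that letter is the colour. Near holes of equal colour would give
  codewords of \<open>P\<close> at distance at most 2.\<close>

lemma shortened_hole_colouring:
  assumes "shortened_one_perfect n q (fibre n q F u)"
  shows "\<exists>\<chi> K. card K = q - 1 \<and> hole_colouring n q {u} F \<chi> K"
proof -
  define C where "C = fibre n q F u"
  obtain P j \<alpha> where P: "one_perfect (n + 1) q P" and j: "j < n + 1" and \<alpha>: "\<alpha> < q"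
    and C: "C = shortening j \<alpha> P"
    unfolding C_def using assms by (auto simp: shortened_one_perfect_def)
  have ex: "\<exists>\<beta>. \<beta> \<in> {0..<q} - {\<alpha>} \<and> insert_pos j \<beta> w \<in> P" if w: "w \<in> holes n q C" for w
  proof -
    have w': "w \<in> words n q" "length w = n"
      using w by (auto simp: holes_def words_lengthD)
    have "insert_pos j \<alpha> w \<in> words (n + 1) q"
      using w' \<alpha> by (intro words_insert_pos)
    with P obtain c where c: "c \<in> P" "hamming_dist (insert_pos j \<alpha> w) c \<in> {0, 1}"
      unfolding one_perfect_def by metis
    have cw: "c \<in> words (n + 1) q" "length c = n + 1"
      using P c(1) by (auto simp: one_perfect_def words_lengthD)
    have eq: "hamming_dist (insert_pos j \<alpha> w) c
        = (if \<alpha> = c ! j then 0 else 1) + hamming_dist w (delete_pos j c)"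
      using hamming_dist_delete_pos[of "insert_pos j \<alpha> w" c j] w' cw j by simp
    have "c ! j \<noteq> \<alpha>"
    proof
      assume "c ! j = \<alpha>"
      then have "delete_pos j c \<in> C"
        using c by (auto simp: C shortening_def)
      with w have "2 \<le> hamming_dist w (delete_pos j c)"
        by (auto simp: holes_def)
      with eq c(2) show False
        by auto
    qed
    with eq c(2) have "hamming_dist w (delete_pos j c) = 0"
      by auto
    then have "w = delete_pos j c"
      using w' cw j by (simp add: hamming_dist_eq_0_iff)
    then have "insert_pos j (c ! j) w = c"
      using cw j by (simp add: insert_pos_delete_pos)
    with c cw j \<open>c ! j \<noteq> \<alpha>\<close> show ?thesis
      by (intro exI[of _ "c ! j"]) (auto intro: words_nth_less)
  qed
  then obtain \<chi> where \<chi>: "\<chi> w \<in> {0..<q} - {\<alpha>}" "insert_pos j (\<chi> w) w \<in> P"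
    if "w \<in> holes n q C" for w
    by metis
  have "\<chi> w \<noteq> \<chi> w'" if w: "w \<in> holes n q C" and w': "w' \<in> holes n q C"
    and ne: "w \<noteq> w'" and le: "hamming_dist w w' \<le> 2" for w w'
  proof -
    have len: "length w = n" "length w' = n"
      using w w' by (auto simp: holes_def words_lengthD)
    show ?thesis
    proof
      assume eq: "\<chi> w = \<chi> w'"
      have d: "hamming_dist (insert_pos j (\<chi> w) w) (insert_pos j (\<chi> w') w') = hamming_dist w w'"
        using hamming_dist_delete_pos[of "insert_pos j (\<chi> w) w" "insert_pos j (\<chi> w') w'" j]
          len j eq by simp
      have "insert_pos j (\<chi> w) w \<noteq> insert_pos j (\<chi> w') w'"
      proof
        assume "insert_pos j (\<chi> w) w = insert_pos j (\<chi> w') w'"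
        with d have "hamming_dist w w' = 0"
          by simp
        with ne len show False
          by (simp add: hamming_dist_eq_0_iff)
      qed
      then show False
        using one_perfect_dist[OF P] \<chi>(2)[OF w] \<chi>(2)[OF w'] d le by fastforce
    qed
  qed
  \<comment> \<open>The colours are the \<open>q - 1\<close> letters other than
    \<open>\<alpha>\<close>; with a single label the colour depends on the word only.\<close>
  with \<alpha> \<chi>(1) show ?thesis
    unfolding C_def hole_colouring_def
    by (intro exI[of _ "\<lambda>x _. \<chi> x"] exI[of _ "{0..<q} - {\<alpha>}"]) auto
qed

section \<open>Extending a labelled partition\<close>

text \<open>Minimum distance 3 is split into a lower bound and a pair attaining it, which avoids the
  infimum in \<open>min_dist\<close>.\<close>

definition code3 :: "nat \<Rightarrow> nat \<Rightarrow> nat \<Rightarrow> nat list set \<Rightarrow> bool" where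
  "code3 n M q C \<longleftrightarrow> C \<subseteq> words n q \<and> card C = M \<and>
     (\<forall>x\<in>C. \<forall>y\<in>C. x \<noteq> y \<longrightarrow> 3 \<le> hamming_dist x y) \<and>
     (\<exists>x\<in>C. \<exists>y\<in>C. hamming_dist x y = 3)"

lemma code3_is_code: "code3 n M q C \<Longrightarrow> is_code n M 3 q C"
  unfolding is_code_def code3_def
  by (metis hamming_dist_self min_dist_eqI zero_neq_numeral)

lemma hamming_dist_le_card:
  assumes "finite S" "\<And>i. i < length x \<Longrightarrow> x ! i \<noteq> y ! i \<Longrightarrow> i \<in> S"
  shows "hamming_dist x y \<le> card S"
  unfolding hamming_dist_def using assms by (intro card_mono) auto

text \<open>The \<open>k\<close>-tuples over the field, encoded as polynomials of degree below
  \<open>k\<close>: one type serves every \<open>k\<close>, and adding \<open>monom t k\<close>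
  appends a coordinate.\<close>

definition labels :: "nat \<Rightarrow> 'f::{finite,field} poly set" where
  "labels k = {p. \<forall>i\<ge>k. coeff p i = 0}"

lemma labels_closed [simp]:
  "0 \<in> labels k"
  "p \<in> labels k \<Longrightarrow> p' \<in> labels k \<Longrightarrow> p + p' \<in> labels k"
  "p \<in> labels k \<Longrightarrow> p' \<in> labels k \<Longrightarrow> p - p' \<in> labels k"
  "p \<in> labels k \<Longrightarrow> smult a p \<in> labels k"
  by (auto simp: labels_def)

lemma labels_sum: "(\<And>i. i \<in> I \<Longrightarrow> f i \<in> labels k) \<Longrightarrow> sum f I \<in> labels k"
  by (auto simp: labels_def coeff_sum)

lemma labels_monom_eq_iff:
  assumes "p \<in> labels k" "p' \<in> labels k"
  shows "p + monom t k = p' + monom t' k \<longleftrightarrow> p = p' \<and> t = t'"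
proof
  assume eq: "p + monom t k = p' + monom t' k"
  then have "coeff (p + monom t k) k = coeff (p' + monom t' k) k"
    by simp
  then have "t = t'"
    using assms by (simp add: labels_def)
  with eq show "p = p' \<and> t = t'"
    by simp
qed simp

lemma labels_Suc: "labels (Suc k) = (\<lambda>(p, t). p + monom t k) ` (labels k \<times> UNIV)"
proof (intro equalityI subsetI)
  fix p :: "'a poly"
  assume p: "p \<in> labels (Suc k)"
  have "p - monom (coeff p k) k \<in> labels k"
    using p by (auto simp: labels_def Suc_le_eq)
  moreover have "p = (p - monom (coeff p k) k) + monom (coeff p k) k"
    by simp
  ultimately show "p \<in> (\<lambda>(p, t). p + monom t k) ` (labels k \<times> UNIV)"
    by (intro image_eqI[of _ _ "(p - monom (coeff p k) k, coeff p k)"]) auto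
qed (auto simp: labels_def)

lemma labels_0: "labels 0 = {0}"
  by (auto simp: labels_def poly_eq_iff)

lemma finite_labels [simp]: "finite (labels k)"
  by (induction k) (auto simp: labels_0 labels_Suc)

lemma card_labels: "card (labels k :: 'f::{finite,field} poly set) = card (UNIV :: 'f set) ^ k"
proof (induction k)
  case (Suc k)
  have "inj_on (\<lambda>(p :: 'f poly, t). p + monom t k) (labels k \<times> UNIV)"
    by (auto simp: inj_on_def labels_monom_eq_iff)
  with Suc show ?case
    by (simp add: labels_Suc card_image card_cartesian_product)
qed (simp add: labels_0)

text \<open>Every label occurs, because a \<open>code3\<close> code is nonempty. The bound
  \<open>k \<le> n\<close> makes the natural subtraction \<open>n - k\<close> exact.\<close>

definition code_partition ::
    "nat \<Rightarrow> nat \<Rightarrow> nat \<Rightarrow> (nat list \<Rightarrow> 'f::{finite,field} poly) \<Rightarrow> bool" where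
  "code_partition n k q F \<longleftrightarrow> k \<le> n \<and> F ` words n q \<subseteq> labels k \<and>
     (\<forall>u\<in>labels k. code3 n (q ^ (n - k)) q (fibre n q F u))"

section \<open>Letters as elements of a finite field, and the two check sums\<close>

locale field_alphabet =
  fixes q :: nat and dec :: "nat \<Rightarrow> 'f::{finite,field}"
  assumes bij_dec: "bij_betw dec {0..<q} UNIV"
begin

definition enc :: "'f \<Rightarrow> nat" where
  "enc = inv_into {0..<q} dec"

lemma dec_enc [simp]: "dec (enc a) = a"
  unfolding enc_def using bij_dec by (simp add: bij_betw_inv_into_right)

lemma enc_dec [simp]: "x < q \<Longrightarrow> enc (dec x) = x"
  unfolding enc_def using bij_dec by (simp add: bij_betw_inv_into_left)

lemma enc_less [simp]: "enc a < q"
  using bij_dec inv_into_into[of a dec "{0..<q}"] by (simp add: enc_def bij_betw_def)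

lemma dec_eq_iff: "x < q \<Longrightarrow> y < q \<Longrightarrow> dec x = dec y \<longleftrightarrow> x = y"
  by (metis enc_dec)

lemma card_alphabet: "card (UNIV :: 'f set) = q"
  using bij_betw_same_card[OF bij_dec] by simp

text \<open>Together with \<open>dsum\<close> this is the syndrome for the check matrix with columns
  \<open>(e i, 1)\<close>, any two of which are independent when the \<open>e i\<close> are
  distinct.\<close>

definition wsum :: "(nat \<Rightarrow> 'f poly) \<Rightarrow> nat list \<Rightarrow> 'f poly" where
  "wsum e y = (\<Sum>i<length y. smult (dec (y ! i)) (e i))"

definition dsum :: "nat list \<Rightarrow> 'f" where
  "dsum y = (\<Sum>i<length y. dec (y ! i))"

lemma dsum_Cons [simp]: "dsum (a # y) = dec a + dsum y"
  by (simp add: dsum_def sum.lessThan_Suc_shift del: sum.lessThan_Suc)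

text \<open>All letters but the first are free, and the sum then determines the first.\<close>

lemma card_dsum_eq: "card {y \<in> words (Suc N) q. dsum y = t} = q ^ N"
proof -
  have "bij_betw (\<lambda>y. enc (t - dsum y) # y) (words N q) {y \<in> words (Suc N) q. dsum y = t}"
  proof (rule bij_betwI[where g = tl])
    show "(\<lambda>y. enc (t - dsum y) # y) \<in> words N q \<rightarrow> {y \<in> words (Suc N) q. dsum y = t}"
      by (auto simp: words_def)
    show "tl \<in> {y \<in> words (Suc N) q. dsum y = t} \<rightarrow> words N q"
      by (auto simp: words_def dest: list.set_sel(2)[rotated])
    fix y
    assume "y \<in> {y \<in> words (Suc N) q. dsum y = t}"
    then show "enc (t - dsum (tl y)) # tl y = y"
      by (cases y) (auto simp: words_def)
  qed simp
  then show ?thesis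
    by (simp add: bij_betw_same_card[symmetric] card_words)
qed

text \<open>Agreeing positions cancel, so the number of remaining terms is the Hamming
  distance.\<close>

lemma dsum_diff:
  assumes "length y = length y'"
  shows "dsum y - dsum y' = (\<Sum>i\<in>{i. i < length y \<and> y ! i \<noteq> y' ! i}. dec (y ! i) - dec (y' ! i))"
proof -
  have "dsum y - dsum y' = (\<Sum>i<length y. dec (y ! i) - dec (y' ! i))"
    using assms by (simp add: dsum_def sum_subtractf)
  also have "\<dots> = (\<Sum>i\<in>{i. i < length y \<and> y ! i \<noteq> y' ! i}. dec (y ! i) - dec (y' ! i))"
    by (intro sum.mono_neutral_right) auto
  finally show ?thesis .
qed

lemma wsum_diff:
  assumes "length y = length y'"
  shows "wsum e y - wsum e y' =
    (\<Sum>i\<in>{i. i < length y \<and> y ! i \<noteq> y' ! i}. smult (dec (y ! i) - dec (y' ! i)) (e i))"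
proof -
  have "wsum e y - wsum e y' = (\<Sum>i<length y. smult (dec (y ! i) - dec (y' ! i)) (e i))"
    using assms by (simp add: wsum_def sum_subtractf smult_diff_left)
  also have "\<dots> = (\<Sum>i\<in>{i. i < length y \<and> y ! i \<noteq> y' ! i}. smult (dec (y ! i) - dec (y' ! i)) (e i))"
    by (intro sum.mono_neutral_right) auto
  finally show ?thesis .
qed

text \<open>If the words differed in one position only, the difference of the sums would be a single
  nonzero term.\<close>

lemma dsum_eq_imp_dist:
  assumes "y \<in> words N q" "y' \<in> words N q" "y \<noteq> y'" "dsum y = dsum y'"
  shows "2 \<le> hamming_dist y y'"
proof (rule ccontr)
  assume "\<not> 2 \<le> hamming_dist y y'"
  moreover have len: "length y = N" "length y' = N"
    using assms by (auto simp: words_lengthD)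
  then have "hamming_dist y y' \<noteq> 0"
    using assms(3) by (simp add: hamming_dist_eq_0_iff)
  ultimately have "card {i. i < length y \<and> y ! i \<noteq> y' ! i} = 1"
    unfolding hamming_dist_def by linarith
  then obtain i where D: "{i. i < length y \<and> y ! i \<noteq> y' ! i} = {i}"
    by (auto simp: card_1_singleton_iff)
  then have "dec (y ! i) = dec (y' ! i)"
    using dsum_diff[of y y'] len assms(4) by simp
  moreover have "i < N" "y ! i \<noteq> y' ! i"
    using D len by auto
  ultimately show False
    using assms by (simp add: dec_eq_iff words_nth_less)
qed

text \<open>At distance 2, equality of the plain sums makes the two letter differences
  \<open>a\<close> and \<open>- a\<close>. The weighted sums then give
  \<open>smult a (e i - e j) = 0\<close> with distinct weights, so \<open>a = 0\<close>.\<close>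

lemma wsum_eq_imp_dist:
  assumes "y \<in> words N q" "y' \<in> words N q" "y \<noteq> y'" "dsum y = dsum y'" "wsum e y = wsum e y'"
    and inj: "inj_on e {..<N}"
  shows "3 \<le> hamming_dist y y'"
proof (rule ccontr)
  assume "\<not> 3 \<le> hamming_dist y y'"
  then have "hamming_dist y y' = 2"
    using dsum_eq_imp_dist[OF assms(1-4)] by simp
  then obtain i j where D: "{i. i < length y \<and> y ! i \<noteq> y' ! i} = {i, j}" and "i \<noteq> j"
    by (auto simp: hamming_dist_def card_2_iff)
  have len: "length y = N" "length y' = N"
    using assms by (auto simp: words_lengthD)
  define a where "a = dec (y ! i) - dec (y' ! i)"
  have "dec (y ! j) - dec (y' ! j) = - a"
    using dsum_diff[of y y'] len assms(4) D \<open>i \<noteq> j\<close>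
    by (simp add: a_def add_eq_0_iff)
  then have "smult a (e i - e j) = 0"
    using wsum_diff[of y y' e] len assms(5) D \<open>i \<noteq> j\<close>
    by (simp add: a_def[symmetric] smult_diff_right)
  moreover have ij: "i < N" "j < N" "y ! i \<noteq> y' ! i"
    using D len by auto
  then have "e i \<noteq> e j"
    using inj \<open>i \<noteq> j\<close> by (auto simp: inj_on_def)
  ultimately have "a = 0"
    by simp
  with ij show False
    using assms(1,2) by (simp add: a_def dec_eq_iff words_nth_less)
qed

lemma q_pos: "0 < q"
  using card_alphabet by (metis finite_UNIV_card_ge_0 finite)

definition extend ::
    "nat \<Rightarrow> nat \<Rightarrow> (nat \<Rightarrow> 'f poly) \<Rightarrow> (nat list \<Rightarrow> 'f poly) \<Rightarrow> nat list \<Rightarrow> 'f poly" where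
  "extend n k e F w = F (take n w) + wsum e (drop n w) + monom (dsum (drop n w)) k"

section \<open>The extended partition\<close>

context
  fixes n k :: nat and e :: "nat \<Rightarrow> 'f poly" and F :: "nat list \<Rightarrow> 'f poly"
  assumes F: "code_partition n k q F"
    and e: "bij_betw e {..<q ^ k} (labels k)"
begin

lemma wsum_in_labels: "y \<in> words (q ^ k) q \<Longrightarrow> wsum e y \<in> labels k"
  unfolding wsum_def using bij_betwE[OF e] by (intro labels_sum labels_closed) (auto simp: words_lengthD)

lemma label_in_labels: "x \<in> words n q \<Longrightarrow> F x \<in> labels k"
  using F by (auto simp: code_partition_def)

lemma extend_append:
  "x \<in> words n q \<Longrightarrow> extend n k e F (x @ y) = F x + wsum e y + monom (dsum y) k"
  by (simp add: extend_def words_lengthD)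

text \<open>Coefficient \<open>k\<close> of the label fixes the plain sum of the tail
  \<open>y\<close>; the lower coefficients then fix the label of the head \<open>x\<close>. Thus
  each admissible tail contributes one copy of a code of the smaller partition.\<close>

lemma fibre_extend:
  assumes u: "u \<in> labels k"
  shows "fibre (n + q ^ k) q (extend n k e F) (u + monom t k) =
    (\<Union>y\<in>{y \<in> words (q ^ k) q. dsum y = t}. (\<lambda>x. x @ y) ` fibre n q F (u - wsum e y))"
proof (intro equalityI subsetI)
  fix w
  assume "w \<in> fibre (n + q ^ k) q (extend n k e F) (u + monom t k)"
  then have w: "w \<in> words (n + q ^ k) q" "extend n k e F w = u + monom t k"
    by (auto simp: fibre_def)
  note td = words_take_drop[OF w(1)]
  have "F (take n w) + wsum e (drop n w) = u \<and> dsum (drop n w) = t"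
    using w(2) td u unfolding extend_def
    by (subst (asm) labels_monom_eq_iff) (auto intro!: labels_closed label_in_labels wsum_in_labels)
  then have "drop n w \<in> {y \<in> words (q ^ k) q. dsum y = t}"
    "take n w \<in> fibre n q F (u - wsum e (drop n w))"
    using td by (auto simp: fibre_def algebra_simps)
  then show "w \<in> (\<Union>y\<in>{y \<in> words (q ^ k) q. dsum y = t}.
      (\<lambda>x. x @ y) ` fibre n q F (u - wsum e y))"
    by (intro UN_I image_eqI[of w _ "take n w"]) simp_all
next
  fix w
  assume "w \<in> (\<Union>y\<in>{y \<in> words (q ^ k) q. dsum y = t}.
      (\<lambda>x. x @ y) ` fibre n q F (u - wsum e y))"
  then obtain x y where "w = x @ y" "y \<in> words (q ^ k) q" "dsum y = t"
    "x \<in> words n q" "F x = u - wsum e y"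
    by (auto simp: fibre_def)
  then show "w \<in> fibre (n + q ^ k) q (extend n k e F) (u + monom t k)"
    by (simp add: fibre_def extend_append words_append_iff words_lengthD)
qed

lemma card_fibre_extend:
  assumes u: "u \<in> labels k"
  shows "card (fibre (n + q ^ k) q (extend n k e F) (u + monom t k)) = q ^ (n + q ^ k - Suc k)"
proof -
  \<comment> \<open>Fixing the sum leaves \<open>N = q ^ k - 1\<close> free letters in the
    tail.\<close>
  obtain N where N: "q ^ k = Suc N"
    using q_pos by (metis gr0_implies_Suc zero_less_power)
  let ?Y = "{y \<in> words (q ^ k) q. dsum y = t}"
  have card: "card ((\<lambda>x. x @ y) ` fibre n q F (u - wsum e y)) = q ^ (n - k)" if "y \<in> ?Y" for y
  proof -
    have "u - wsum e y \<in> labels k"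
      using that u by (auto intro!: labels_closed wsum_in_labels)
    then have "card (fibre n q F (u - wsum e y)) = q ^ (n - k)"
      using F by (auto simp: code_partition_def code3_def)
    then show ?thesis
      by (simp add: card_image inj_on_def)
  qed
  have "card (fibre (n + q ^ k) q (extend n k e F) (u + monom t k))
      = (\<Sum>y\<in>?Y. card ((\<lambda>x. x @ y) ` fibre n q F (u - wsum e y)))"
    unfolding fibre_extend[OF u]
  proof (rule card_UN_disjoint)
    show "finite ?Y"
      by simp
    show "\<forall>y\<in>?Y. finite ((\<lambda>x. x @ y) ` fibre n q F (u - wsum e y))"
      by (simp add: fibre_def)
    show "\<forall>y\<in>?Y. \<forall>y'\<in>?Y. y \<noteq> y' \<longrightarrow>
        ((\<lambda>x. x @ y) ` fibre n q F (u - wsum e y)) \<inter>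
        ((\<lambda>x. x @ y') ` fibre n q F (u - wsum e y')) = {}"
      by (auto simp: fibre_def words_def)
  qed
  also have "\<dots> = card ?Y * q ^ (n - k)"
    using card by simp
  also have "\<dots> = q ^ (N + (n - k))"
    by (simp add: N card_dsum_eq power_add)
  also have "N + (n - k) = n + q ^ k - Suc k"
    using F by (simp add: N code_partition_def)
  finally show ?thesis .
qed

text \<open>For two words of one code, equal tails leave the distance to a smaller code, equal heads
  force both check sums of the tails to agree, and otherwise the heads contribute at least 1 and the
  tails at least 2.\<close>

lemma code_partition_extend: "code_partition (n + q ^ k) (Suc k) q (extend n k e F)"
  unfolding code_partition_def
proof (intro conjI ballI)
  show "Suc k \<le> n + q ^ k"
  proof -
    have "k + 1 \<le> n + q ^ k"
      using F q_pos by (intro add_mono) (simp_all add: code_partition_def Suc_le_eq)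
    then show ?thesis
      by simp
  qed
  show "extend n k e F ` words (n + q ^ k) q \<subseteq> labels (Suc k)"
    using words_take_drop
    by (auto simp: labels_Suc extend_def image_iff intro!: bexI labels_closed label_in_labels wsum_in_labels)
  fix v :: "'f poly"
  assume "v \<in> labels (Suc k)"
  then obtain u t where v: "v = u + monom t k" and u: "u \<in> labels k"
    by (auto simp: labels_Suc)
  let ?C = "fibre (n + q ^ k) q (extend n k e F) v"
  have sub: "u - wsum e y \<in> labels k" if "y \<in> words (q ^ k) q" for y
    using that u by (auto intro!: labels_closed wsum_in_labels)
  have code: "code3 n (q ^ (n - k)) q (fibre n q F p)" if "p \<in> labels k" for p
    using that F by (auto simp: code_partition_def)
  show "code3 (n + q ^ k) (q ^ (n + q ^ k - Suc k)) q ?C"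
    unfolding code3_def
  proof (intro conjI ballI impI)
    show "?C \<subseteq> words (n + q ^ k) q"
      by (auto simp: fibre_def)
    show "card ?C = q ^ (n + q ^ k - Suc k)"
      unfolding v by (rule card_fibre_extend[OF u])
  next
    fix w w'
    assume "w \<in> ?C" "w' \<in> ?C" and ne: "w \<noteq> w'"
    then obtain x y x' y' where w: "w = x @ y" "w' = x' @ y'"
      and y: "y \<in> words (q ^ k) q" "y' \<in> words (q ^ k) q" "dsum y = dsum y'"
      and x: "x \<in> fibre n q F (u - wsum e y)" "x' \<in> fibre n q F (u - wsum e y')"
      unfolding v fibre_extend[OF u] by auto
    have len: "length x = n" "length x' = n"
      using x by (auto simp: fibre_def words_lengthD)
    then have d: "hamming_dist w w' = hamming_dist x x' + hamming_dist y y'"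
      by (simp add: w hamming_dist_append)
    show "3 \<le> hamming_dist w w'"
    proof (cases "y = y'")
      case True
      then have "3 \<le> hamming_dist x x'"
        using code[OF sub[OF y(1)]] x ne w by (auto simp: code3_def)
      with d show ?thesis
        by simp
    next
      case False
      show ?thesis
      proof (cases "x = x'")
        case True
        then have "wsum e y = wsum e y'"
          using x by (auto simp: fibre_def)
        with False y show ?thesis
          using wsum_eq_imp_dist[of y "q ^ k" y' e] bij_betw_imp_inj_on[OF e] d by simp
      next
        case ne': False
        then have "1 \<le> hamming_dist x x'"
          using hamming_dist_eq_0_iff[of x x'] len by simp
        with dsum_eq_imp_dist[OF y(1,2) False y(3)] d show ?thesis
          by simp
      qed
    qed
  next
    \<comment> \<open>Distance 3 is attained by appending one fixed tail to a pair from a smaller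
      code.\<close>
    have "{y \<in> words (q ^ k) q. dsum y = t} \<noteq> {}"
      using card_dsum_eq[of "q ^ k - 1" t] q_pos by (intro notI) simp
    then obtain y where y: "y \<in> words (q ^ k) q" "dsum y = t"
      by auto
    then obtain x x' where "x \<in> fibre n q F (u - wsum e y)" "x' \<in> fibre n q F (u - wsum e y)"
      and d: "hamming_dist x x' = 3"
      using code[OF sub[OF y(1)]] unfolding code3_def by blast
    moreover from this have "hamming_dist (x @ y) (x' @ y) = 3"
      by (simp add: hamming_dist_append fibre_def words_def)
    ultimately show "\<exists>w\<in>?C. \<exists>w'\<in>?C. hamming_dist w w' = 3"
      unfolding v fibre_extend[OF u] using y by blast
  qed
qed

text \<open>The tail with letters 1 at weight \<open>0\<close> and -1 at weight \<open>u\<close>: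
  plain sum 0, weighted sum \<open>- u\<close>. All nonzero labels share the letter at weight
  \<open>0\<close>, which keeps these tails close together.\<close>

definition probe :: "'f poly \<Rightarrow> nat list" where
  "probe u = (let y = replicate (q ^ k) (enc 0); i = inv_into {..<q ^ k} e in
     if u = 0 then y else y[i 0 := enc 1, i u := enc (- 1)])"

lemma index_e:
  assumes "u \<in> labels k"
  shows "inv_into {..<q ^ k} e u < q ^ k" "e (inv_into {..<q ^ k} e u) = u"
  using assms e inv_into_into[of u e "{..<q ^ k}"]
  by (auto simp: bij_betw_def f_inv_into_f)

lemma wsum_list_update:
  "i < length y \<Longrightarrow> wsum e (y[i := a]) = wsum e y + smult (dec a - dec (y ! i)) (e i)"
  by (simp add: wsum_def sum.remove[of "{..<length y}" i] smult_diff_left)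

lemma dsum_list_update:
  "i < length y \<Longrightarrow> dsum (y[i := a]) = dsum y + (dec a - dec (y ! i))"
  by (simp add: dsum_def sum.remove[of "{..<length y}" i])

lemma probe:
  assumes u: "u \<in> labels k"
  shows "probe u \<in> words (q ^ k) q" "dsum (probe u) = 0" "wsum e (probe u) = - u"
proof -
  have "replicate (q ^ k) (enc 0) \<in> words (q ^ k) q"
    by (auto simp: words_def)
  then show "probe u \<in> words (q ^ k) q"
    by (auto simp: probe_def Let_def intro!: words_list_update)
  have 0: "dsum (replicate (q ^ k) (enc 0)) = 0" "wsum e (replicate (q ^ k) (enc 0)) = 0"
    by (auto simp: dsum_def wsum_def)
  \<comment> \<open>The two updates hit different positions, so neither overwrites the
    other.\<close>
  have "inv_into {..<q ^ k} e 0 \<noteq> inv_into {..<q ^ k} e u" if "u \<noteq> 0"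
    using that index_e[OF u] index_e[of 0] by auto
  then show "dsum (probe u) = 0" "wsum e (probe u) = - u"
    using index_e[OF u] index_e[of 0] 0
    by (auto simp: probe_def Let_def dsum_list_update wsum_list_update)
qed

text \<open>For nonzero labels the probes agree at weight \<open>0\<close> and can differ only at
  the weights \<open>u\<close> and \<open>u'\<close>; the probe of \<open>0\<close> differs from
  that of \<open>u\<close> only at the weights \<open>0\<close> and \<open>u\<close>.\<close>

lemma probe_dist:
  assumes "u \<in> labels k" "u' \<in> labels k"
  shows "hamming_dist (probe u) (probe u') \<le> 2"
proof -
  let ?i = "inv_into {..<q ^ k} e"
  define S where "S = (if u = 0 then {?i 0, ?i u'} else if u' = 0 then {?i 0, ?i u} else {?i u, ?i u'})"
  have "hamming_dist (probe u) (probe u') \<le> card S"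
  proof (rule hamming_dist_le_card)
    show "i \<in> S" if "probe u ! i \<noteq> probe u' ! i" for i
    proof (rule ccontr)
      assume "i \<notin> S"
      with that show False
        by (simp add: S_def probe_def Let_def split: if_splits)
    qed
  qed (simp add: S_def)
  moreover have "card {i, j} \<le> 2" for i j :: nat
    by (cases "i = j") simp_all
  then have "card S \<le> 2"
    unfolding S_def by presburger
  ultimately show ?thesis
    by simp
qed

text \<open>The partition is a section of the code: \<open>x @ probe u\<close> lies in the code labelled \<open>0\<close> of the
  extension iff \<open>x\<close> has label \<open>u\<close>.\<close>

lemma hole_append_probe:
  assumes u: "u \<in> labels k" and x: "x \<in> holes n q (fibre n q F u)"
  shows "x @ probe u \<in> holes (n + q ^ k) q (fibre (n + q ^ k) q (extend n k e F) 0)"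
  unfolding holes_def
proof (intro CollectI conjI ballI)
  have xw: "x \<in> words n q"
    using x by (simp add: holes_def)
  note p = probe[OF u]
  show "x @ probe u \<in> words (n + q ^ k) q"
    using xw p by (simp add: words_append_iff words_lengthD)
  fix c
  assume "c \<in> fibre (n + q ^ k) q (extend n k e F) 0"
  then have "c \<in> fibre (n + q ^ k) q (extend n k e F) (0 + monom 0 k)"
    by simp
  then obtain x' y where c: "c = x' @ y" and y: "y \<in> words (q ^ k) q" "dsum y = 0"
    and x': "x' \<in> fibre n q F (0 - wsum e y)"
    by (subst (asm) fibre_extend) auto
  have d: "hamming_dist (x @ probe u) c = hamming_dist x x' + hamming_dist (probe u) y"
    using xw x' by (simp add: c hamming_dist_append fibre_def words_def)
  show "2 \<le> hamming_dist (x @ probe u) c"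
  proof (cases "probe u = y")
    case True
    then have "x' \<in> fibre n q F u"
      using x' p(3) by simp
    with x d show ?thesis
      by (fastforce simp: holes_def)
  next
    \<comment> \<open>Both tails have plain sum 0, so they alone contribute distance 2.\<close>
    case False
    with p(2) y(2) have "2 \<le> hamming_dist (probe u) y"
      by (intro dsum_eq_imp_dist[OF p(1) y(1)]) simp_all
    with d show ?thesis
      by simp
  qed
qed

text \<open>Appending probes turns both kinds of conflict, two near holes of one code and one hole
  of two codes, into a pair of distinct holes of the code labelled \<open>0\<close> at distance at
  most 2.\<close>

lemma hole_colouring_extend:
  assumes col: "hole_colouring (n + q ^ k) q {0} (extend n k e F) \<chi> K"
  shows "hole_colouring n q (labels k) F (\<lambda>x u. \<chi> (x @ probe u) 0) K"
proof -
  let ?C = "fibre (n + q ^ k) q (extend n k e F) 0"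
  have \<chi>: "\<chi> w 0 \<in> K" if "w \<in> holes (n + q ^ k) q ?C" for w
    using col that by (auto simp: hole_colouring_def)
  have ne: "\<chi> w 0 \<noteq> \<chi> w' 0" if "w \<in> holes (n + q ^ k) q ?C" "w' \<in> holes (n + q ^ k) q ?C"
    "w \<noteq> w'" "hamming_dist w w' \<le> 2" for w w'
    using col that by (auto simp: hole_colouring_def)
  have inj: "probe u \<noteq> probe u'" if "u \<in> labels k" "u' \<in> labels k" "u \<noteq> u'" for u u'
    using probe(3)[OF that(1)] probe(3)[OF that(2)] that(3) by auto
  show ?thesis
    unfolding hole_colouring_def
  proof (intro conjI ballI impI)
    fix u x
    assume "u \<in> labels k" "x \<in> holes n q (fibre n q F u)"
    then show "\<chi> (x @ probe u) 0 \<in> K"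
      by (intro \<chi> hole_append_probe)
  next
    fix u x x'
    assume u: "u \<in> labels k" and x: "x \<in> holes n q (fibre n q F u)" "x' \<in> holes n q (fibre n q F u)"
      "x \<noteq> x' \<and> hamming_dist x x' \<le> 2"
    then show "\<chi> (x @ probe u) 0 \<noteq> \<chi> (x' @ probe u) 0"
      by (intro ne hole_append_probe) (auto simp: hamming_dist_append holes_def words_lengthD)
  next
    fix u u' x
    assume u: "u \<in> labels k" "u' \<in> labels k" "u \<noteq> u'"
      and x: "x \<in> holes n q (fibre n q F u) \<inter> holes n q (fibre n q F u')"
    then show "\<chi> (x @ probe u) 0 \<noteq> \<chi> (x @ probe u') 0"
      using inj probe_dist by (intro ne hole_append_probe) (auto simp: hamming_dist_append)
  qed
qed

end

end

section \<open>A partition of \<open>H(4,4)\<close>\<close>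

datatype gf4 = G0 | G1 | Gw | Gv

lemma UNIV_gf4: "UNIV = {G0, G1, Gw, Gv}"
  by (auto intro: gf4.exhaust)

instance gf4 :: finite
  by standard (simp add: UNIV_gf4)

instantiation gf4 :: field
begin

definition "0 = G0"
definition "1 = G1"
definition "- (a :: gf4) = a"
definition "a + b = (case (a, b) of
    (G0, c) \<Rightarrow> c | (c, G0) \<Rightarrow> c
  | (G1, Gw) \<Rightarrow> Gv | (Gw, G1) \<Rightarrow> Gv
  | (G1, Gv) \<Rightarrow> Gw | (Gv, G1) \<Rightarrow> Gw
  | (Gw, Gv) \<Rightarrow> G1 | (Gv, Gw) \<Rightarrow> G1
  | _ \<Rightarrow> G0)"
definition "a - b = a + (b :: gf4)"
definition "a * b = (case (a, b) of
    (G0, _) \<Rightarrow> G0 | (_, G0) \<Rightarrow> G0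
  | (G1, c) \<Rightarrow> c | (c, G1) \<Rightarrow> c
  | (Gw, Gw) \<Rightarrow> Gv | (Gv, Gv) \<Rightarrow> Gw
  | _ \<Rightarrow> G1)"
definition "inverse a = (case a of G0 \<Rightarrow> G0 | G1 \<Rightarrow> G1 | Gw \<Rightarrow> Gv | Gv \<Rightarrow> Gw)"
definition "a div b = a * inverse (b :: gf4)"

instance
proof
  fix a b c :: gf4
  show "a + b + c = a + (b + c)" "(a + b) * c = a * c + b * c" "a * b * c = a * (b * c)"
    by (cases a; cases b; cases c; simp add: plus_gf4_def times_gf4_def)+
  show "a + b = b + a" "a * b = b * a"
    by (cases a; cases b; simp add: plus_gf4_def times_gf4_def)+
  show "0 + a = a" "1 * a = a" "- a + a = 0" "a \<noteq> 0 \<Longrightarrow> inverse a * a = 1" "inverse 0 = (0 :: gf4)"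
    by (cases a; simp add: plus_gf4_def times_gf4_def zero_gf4_def one_gf4_def uminus_gf4_def
        inverse_gf4_def)+
  show "a - b = a + - b" "a div b = a * inverse b" "0 \<noteq> (1 :: gf4)"
    by (simp_all add: minus_gf4_def uminus_gf4_def divide_gf4_def zero_gf4_def one_gf4_def)
qed

end

lemma card_gf4: "card (UNIV :: gf4 set) = 4"
  by (simp add: UNIV_gf4)

text \<open>A partition of \<open>H(4,4)\<close> into 16 codes with parameters \<open>(4, 16, 3)\<close>, found by computer
  search. Row \<open>4 d + c\<close>, column \<open>4 b + a\<close> holds the label of the word \<open>[a, b, c, d]\<close>, as
  \<open>n_lists\<close> lets the first letter vary fastest.\<close>

definition table :: "nat list list" where
  "table = [
    [ 0,  1,  2,  3,  4,  5,  6,  7,  8,  9, 10, 11, 12, 13, 14, 15],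
    [13, 12,  4,  6,  2, 11,  0,  9,  5,  7, 15, 14,  1,  3,  8, 10],
    [ 7, 10,  9,  8, 15, 14, 12, 13,  3,  0,  1,  2, 11,  6,  5,  4],
    [14, 15, 11,  5, 10,  8,  3,  1,  6,  4, 13, 12,  9,  2,  7,  0],
    [ 6,  4, 13, 12,  9,  2, 11,  0, 14, 15,  7,  5, 10,  8,  3,  1],
    [ 3,  0,  1,  2,  7,  6,  5,  4, 11, 10,  9,  8, 15, 14, 12, 13],
    [ 5, 11, 15, 14,  1,  3,  8, 10, 13, 12,  4,  6,  2,  7,  0,  9],
    [ 8,  9, 10,  7, 12, 13, 14, 15,  0,  1,  2,  3,  4,  5,  6, 11],
    [15,  7,  8, 10, 13, 12,  1, 14,  2,  3,  0,  4,  5, 11,  9,  6],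
    [ 9,  5, 14, 11,  8, 15, 10,  3, 12, 13,  6,  1,  0,  4,  2,  7],
    [ 4,  2,  3,  0,  6,  9,  7,  5, 10,  8, 11, 15, 14,  1, 13, 12],
    [ 1,  6, 12, 13, 11,  0,  4,  2,  7, 14,  5,  9,  3, 10, 15,  8],
    [11, 14,  5,  9,  3, 10, 15,  8,  1,  6, 12, 13,  7,  0,  4,  2],
    [10,  8,  7, 15, 14,  1, 13, 12,  4,  2,  3,  0,  6,  9, 11,  5],
    [12, 13,  6,  1,  0,  4,  2, 11,  9,  5, 14,  7,  8, 15, 10,  3],
    [ 2,  3,  0,  4,  5,  7,  9,  6, 15, 11,  8, 10, 13, 12,  1, 14]]"

section \<open>Checking the table by evaluation\<close>

definition labelled :: "(nat list \<times> nat) list" where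
  "labelled = zip (List.n_lists 4 [0..<4]) (concat table)"

definition block :: "nat \<Rightarrow> nat list list" where
  "block u = map fst (filter (\<lambda>p. snd p = u) labelled)"

text \<open>A recursive form of \<open>hamming_dist\<close> that can be evaluated.\<close>

fun dist_list :: "nat list \<Rightarrow> nat list \<Rightarrow> nat" where
  "dist_list (a # x) (b # y) = (if a = b then 0 else 1) + dist_list x y"
| "dist_list _ _ = 0"

definition good_block :: "nat list list \<Rightarrow> bool" where
  "good_block B \<longleftrightarrow> length B = 16 \<and>
      list_all (\<lambda>x. list_all (\<lambda>y. x = y \<or> 3 \<le> dist_list x y) B) B \<and>
      list_ex (\<lambda>x. list_ex (\<lambda>y. dist_list x y = 3) B) B"

definition separated :: "nat list list \<Rightarrow> nat list list \<Rightarrow> bool" where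
  "separated X B \<longleftrightarrow> list_all (\<lambda>x. list_all (\<lambda>c. 2 \<le> dist_list x c) B) X"

lemma length_table: "length (concat table) = 256"
  by code_simp

lemma table_less: "list_all (\<lambda>v. v < 16) (concat table)"
  by code_simp

lemma good_blocks: "list_all good_block (map block [0..<16])"
  by code_simp

text \<open>The holes used in the final contradiction. The codes 11, 13 and 15 are linked by their
  common hole \<open>[1,2,2,0]\<close>, and 15 shares \<open>[3,0,0,1]\<close> with 11 and
  \<open>[2,0,3,3]\<close> with 13.\<close>

lemma separated_11: "separated [[1,0,0,0], [1,2,2,0], [3,0,0,1], [1,2,0,1]] (block 11)"
  by code_simp

lemma separated_13: "separated [[2,0,2,0], [1,2,2,0], [1,0,3,0], [2,0,3,3]] (block 13)"
  by code_simp

lemma separated_15: "separated [[2,0,0,0], [1,2,2,0], [3,0,0,1], [1,0,2,2], [1,0,0,3], [0,0,2,3],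
    [2,0,3,3]] (block 15)"
  by code_simp

lemma dist_list_eq: "length x = length y \<Longrightarrow> dist_list x y = hamming_dist x y"
  by (induction x y rule: list_induct2) auto

definition label_of :: "nat list \<Rightarrow> nat" where
  "label_of x = the (map_of labelled x)"

text \<open>The table has exactly one entry per word, so \<open>zip\<close> truncates
  nothing.\<close>

lemma map_fst_labelled: "map fst labelled = List.n_lists 4 [0..<4]"
  by (simp add: labelled_def length_table length_n_lists)

text \<open>Each word occurs once as a first component, so membership of a pair in
  \<open>labelled\<close> is the same as a successful lookup.\<close>

lemma in_block_iff: "x \<in> set (block u) \<longleftrightarrow> x \<in> words 4 4 \<and> label_of x = u"
proof -
  have "x \<in> set (block u) \<longleftrightarrow> (x, u) \<in> set labelled"
    by (force simp: block_def)
  also have "\<dots> \<longleftrightarrow> map_of labelled x = Some u"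
    by (simp add: map_fst_labelled distinct_n_lists)
  also have "\<dots> \<longleftrightarrow> map_of labelled x \<noteq> None \<and> label_of x = u"
    by (auto simp: label_of_def)
  also have "map_of labelled x \<noteq> None \<longleftrightarrow> x \<in> fst ` set labelled"
    by (simp add: map_of_eq_None_iff)
  also have "fst ` set labelled = words 4 4"
    by (auto simp: words_def set_n_lists map_fst_labelled simp flip: set_map)
  finally show ?thesis .
qed

lemma distinct_block: "distinct (block u)"
  by (simp add: block_def distinct_map_filter map_fst_labelled distinct_n_lists)

lemma label_of_less: "x \<in> words 4 4 \<Longrightarrow> label_of x < 16"
proof -
  assume "x \<in> words 4 4"
  then have "x \<in> set (block (label_of x))"
    by (simp add: in_block_iff)
  then have "label_of x \<in> set (concat table)"
    by (auto simp: block_def labelled_def dest: set_zip_rightD)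
  then show ?thesis
    using table_less unfolding list_all_iff by blast
qed

lemma code3_block:
  assumes "u < 16"
  shows "code3 4 (4 ^ (4 - 2)) 4 (set (block u))"
proof -
  have good: "good_block (block u)"
    using good_blocks assms by (simp add: list_all_iff)
  have len: "length x = 4" if "x \<in> set (block u)" for x
    using that by (simp add: in_block_iff words_def)
  have "card (set (block u)) = 16"
    using good distinct_block by (simp add: good_block_def distinct_card)
  moreover have "set (block u) \<subseteq> words 4 4"
    by (auto simp: in_block_iff)
  ultimately show ?thesis
    using good len
    by (fastforce simp: code3_def good_block_def list_all_iff list_ex_iff dist_list_eq)
qed

lemma holes_block:
  assumes "separated X (block u)" "set X \<subseteq> words 4 4"
  shows "set X \<subseteq> holes 4 4 (set (block u))"
proof
  fix x
  assume x: "x \<in> set X"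
  have "2 \<le> hamming_dist x c" if "c \<in> set (block u)" for c
  proof -
    have "length x = length c"
      using that x assms(2) by (auto simp: in_block_iff words_def)
    moreover have "2 \<le> dist_list x c"
      using assms(1) x that by (simp add: separated_def list_all_iff)
    ultimately show ?thesis
      by (simp add: dist_list_eq)
  qed
  with x assms(2) show "x \<in> holes 4 4 (set (block u))"
    by (auto simp: holes_def)
qed

text \<open>Excluding two distinct colours leaves one; all forced equalities of colours below come
  from this.\<close>

lemma three_colours:
  assumes "card K = 3" "a \<in> K" "b \<in> K" "x \<in> K" "y \<in> K"
    and "a \<noteq> b" "x \<noteq> a" "x \<noteq> b" "y \<noteq> a" "y \<noteq> b"
  shows "x = y"
  using assms by (auto simp: card_3_iff)

section \<open>The table admits no simultaneous colouring, whichever bijection turns its numbers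
  into labels\<close>

context
  fixes lab :: "nat \<Rightarrow> gf4 poly"
  assumes lab: "bij_betw lab {..<16} (labels 2)"
begin

lemma fibre_lab:
  assumes "u < 16"
  shows "fibre 4 4 (lab \<circ> label_of) (lab u) = set (block u)"
  using assms label_of_less bij_betw_imp_inj_on[OF lab]
  by (auto simp: fibre_def in_block_iff inj_on_def)

lemma code_partition_table: "code_partition 4 2 4 (lab \<circ> label_of)"
  unfolding code_partition_def
proof (intro conjI ballI)
  show "(lab \<circ> label_of) ` words 4 4 \<subseteq> labels 2"
    using label_of_less bij_betwE[OF lab] by auto
  fix p
  assume "p \<in> (labels 2 :: gf4 poly set)"
  then obtain u where "u < 16" "p = lab u"
    using lab by (auto simp: bij_betw_def)
  then show "code3 4 (4 ^ (4 - 2)) 4 (fibre 4 4 (lab \<circ> label_of) p)"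
    by (simp only: fibre_lab code3_block)
qed simp

lemma no_hole_colouring_table:
  assumes K: "card K = 3" and col: "hole_colouring 4 4 (labels 2) (lab \<circ> label_of) \<chi> K"
  shows False
proof -
  define c where "c u x = \<chi> x (lab u)" for u x
  define H where "H u = holes 4 4 (set (block u))" for u
  have L: "lab u \<in> labels 2" if "u < 16" for u
    using that bij_betwE[OF lab] by simp
  have fib: "holes 4 4 (fibre 4 4 (lab \<circ> label_of) (lab u)) = H u" if "u < 16" for u
    using that by (simp add: fibre_lab H_def)
  have in_K: "c u x \<in> K" if "u < 16" "x \<in> H u" for u x
    using col that L[of u] fib[of u] unfolding hole_colouring_def c_def by auto
  have near: "c u x \<noteq> c u x'"
    if "u < 16" "x \<in> H u" "x' \<in> H u" "x \<noteq> x'" "hamming_dist x x' \<le> 2" for u x x'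
    using col that L[of u] fib[of u] unfolding hole_colouring_def c_def by auto
  have same: "c u x \<noteq> c u' x"
    if "u < 16" "u' < 16" "u \<noteq> u'" "x \<in> H u" "x \<in> H u'" for u u' x
  proof -
    have "lab u \<noteq> lab u'"
      using that bij_betw_imp_inj_on[OF lab] by (auto simp: inj_on_def)
    then show ?thesis
      using col that L[of u] L[of u'] fib[of u] fib[of u'] unfolding hole_colouring_def c_def by auto
  qed
  have H11: "[1,0,0,0] \<in> H 11" "[1,2,2,0] \<in> H 11" "[3,0,0,1] \<in> H 11" "[1,2,0,1] \<in> H 11"
    using holes_block[OF separated_11] by (auto simp: H_def words_def)
  have H13: "[2,0,2,0] \<in> H 13" "[1,2,2,0] \<in> H 13" "[1,0,3,0] \<in> H 13" "[2,0,3,3] \<in> H 13"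
    using holes_block[OF separated_13] by (auto simp: H_def words_def)
  have H15: "[2,0,0,0] \<in> H 15" "[1,2,2,0] \<in> H 15" "[3,0,0,1] \<in> H 15" "[1,0,2,2] \<in> H 15"
    "[1,0,0,3] \<in> H 15" "[0,0,2,3] \<in> H 15" "[2,0,3,3] \<in> H 15"
    using holes_block[OF separated_15] by (auto simp: H_def words_def)
  \<comment> \<open>No label of the word \<open>[1,2,2,0]\<close> can get the colour of \<open>c 15 [2,0,3,3]\<close>.\<close>
  note facts = in_K near same H11 H13 H15
  \<comment> \<open>Both holes are near \<open>[1,0,0,3]\<close> and \<open>[2,0,3,3]\<close>, which
    are near each other.\<close>
  have "c 15 [2,0,0,0] = c 15 [0,0,2,3]"
    by (rule three_colours[OF K, of "c 15 [1,0,0,3]" "c 15 [2,0,3,3]"])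
      (simp_all add: facts del: One_nat_def)
  \<comment> \<open>\<open>[1,0,2,2]\<close> is at distance 3 from \<open>[2,0,0,0]\<close>; their
    colours differ because \<open>[0,0,2,3]\<close>, which is near \<open>[1,0,2,2]\<close>, has the
    colour of \<open>[2,0,0,0]\<close>.\<close>
  then have "c 15 [1,0,2,2] = c 15 [2,0,3,3]"
    using near[of 15 "[1,0,2,2]" "[0,0,2,3]"]
    by (intro three_colours[OF K, of "c 15 [1,0,0,3]" "c 15 [2,0,0,0]"])
      (simp_all add: facts del: One_nat_def)
  moreover have "c 15 [3,0,0,1] = c 15 [2,0,3,3]"
    by (rule three_colours[OF K, of "c 15 [1,0,0,3]" "c 15 [2,0,0,0]"])
      (simp_all add: facts del: One_nat_def)
  moreover have "c 11 [1,2,2,0] = c 11 [3,0,0,1]"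
    by (rule three_colours[OF K, of "c 11 [1,0,0,0]" "c 11 [1,2,0,1]"])
      (simp_all add: facts del: One_nat_def)
  moreover have "c 13 [1,2,2,0] = c 13 [2,0,3,3]"
    by (rule three_colours[OF K, of "c 13 [2,0,2,0]" "c 13 [1,0,3,0]"])
      (simp_all add: facts del: One_nat_def)
  \<comment> \<open>With the equalities above, each of these excludes the colour of
    \<open>c 15 [2,0,3,3]\<close> for one label of \<open>[1,2,2,0]\<close>.\<close>
  moreover have "c 15 [1,2,2,0] \<noteq> c 15 [1,0,2,2]" "c 11 [3,0,0,1] \<noteq> c 15 [3,0,0,1]"
    "c 13 [2,0,3,3] \<noteq> c 15 [2,0,3,3]"
    by (simp_all add: facts del: One_nat_def)
  \<comment> \<open>As a common hole of three codes, \<open>[1,2,2,0]\<close> uses up all three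
    colours.\<close>
  moreover have "c 11 [1,2,2,0] \<noteq> c 13 [1,2,2,0]" "c 11 [1,2,2,0] \<noteq> c 15 [1,2,2,0]"
    "c 13 [1,2,2,0] \<noteq> c 15 [1,2,2,0]"
    by (simp_all add: facts del: One_nat_def)
  ultimately show False
    using three_colours[OF K, of "c 11 [1,2,2,0]" "c 13 [1,2,2,0]" "c 15 [1,2,2,0]" "c 15 [2,0,3,3]"]
    by (simp add: facts del: One_nat_def)
qed

end

section \<open>Induction on the number of check symbols\<close>

lemma hole_colouring_mono:
  "hole_colouring n q L F \<chi> K \<Longrightarrow> L' \<subseteq> L \<Longrightarrow> hole_colouring n q L' F \<chi> K"
  unfolding hole_colouring_def by (meson subsetD)

lemma enumerate_labels:
  obtains e :: "nat \<Rightarrow> gf4 poly" where "bij_betw e {..<4 ^ k} (labels k)"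
  using ex_bij_betw_nat_finite[of "labels k :: gf4 poly set"]
  by (auto simp: card_labels card_gf4 lessThan_atLeast0)

text \<open>The table starts the induction. A colouring of the extension would restrict to the label
  \<open>0\<close>, and the probes would turn it into a colouring of the smaller partition. The
  equation for \<open>n\<close> avoids division.\<close>

lemma uncolourable_partition:
  assumes "2 \<le> k"
  shows "\<exists>n (F :: nat list \<Rightarrow> gf4 poly). 3 * n + 4 = 4 ^ k \<and> code_partition n k 4 F \<and>
    (\<forall>\<chi> K. card K = 3 \<longrightarrow> \<not> hole_colouring n 4 (labels k) F \<chi> K)"
  using assms
proof (induction k rule: dec_induct)
  case base
  obtain lab :: "nat \<Rightarrow> gf4 poly" where lab: "bij_betw lab {..<4 ^ 2} (labels 2)"
    by (rule enumerate_labels)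
  then have "bij_betw lab {..<16} (labels 2)"
    by simp
  note code_partition_table[OF this] no_hole_colouring_table[OF this]
  moreover have "3 * 4 + 4 = (4 :: nat) ^ 2"
    by simp
  ultimately show ?case
    by blast
next
  case (step k)
  then obtain n and F :: "nat list \<Rightarrow> gf4 poly" where n: "3 * n + 4 = 4 ^ k"
    and F: "code_partition n k 4 F"
    and col: "\<And>\<chi> K. card K = 3 \<Longrightarrow> \<not> hole_colouring n 4 (labels k) F \<chi> K"
    by blast
  obtain dec :: "nat \<Rightarrow> gf4" where "bij_betw dec {0..<4} UNIV"
    using ex_bij_betw_nat_finite[of "UNIV :: gf4 set"] by (auto simp: card_gf4)
  then interpret field_alphabet 4 dec
    by unfold_locales
  obtain e :: "nat \<Rightarrow> gf4 poly" where e: "bij_betw e {..<4 ^ k} (labels k)"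
    by (rule enumerate_labels)
  have "\<not> hole_colouring (n + 4 ^ k) 4 (labels (Suc k)) (extend n k e F) \<chi> K" if "card K = 3" for \<chi> K
    using hole_colouring_extend[OF F e] hole_colouring_mono[of _ _ "labels (Suc k)" _ _ _ "{0}"] col that
    by fastforce
  moreover have "3 * (n + 4 ^ k) + 4 = 4 ^ Suc k"
    using n by simp
  ultimately show ?case
    using code_partition_extend[OF F e] by blast
qed

theorem theorem4:
  fixes m n :: nat
  assumes "m \<ge> 3"
    and "n = (4 ^ m - 4) div 3"
  shows "\<exists>C. is_code n (4 ^ (n - m)) 3 4 C
           \<and> \<not> shortened_one_perfect n 4 C
           \<and> (\<exists>\<P>. partition_on (words n 4) \<P> \<and> C \<in> \<P>
                  \<and> (\<forall>D\<in>\<P>. is_code n (4 ^ (n - m)) 3 4 D))"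
proof -
  \<comment> \<open>One extension turns a partition that has no simultaneous colouring into one
    whose code labelled \<open>0\<close> has none, so the partition for \<open>m - 1\<close> is
    needed.\<close>
  obtain k where k: "m = Suc k" "2 \<le> k"
    using assms(1) by (cases m) auto
  obtain n' and F :: "nat list \<Rightarrow> gf4 poly" where n': "3 * n' + 4 = 4 ^ k"
    and F: "code_partition n' k 4 F"
    and col: "\<And>\<chi> K. card K = 3 \<Longrightarrow> \<not> hole_colouring n' 4 (labels k) F \<chi> K"
    using uncolourable_partition[OF k(2)] by blast
  have n: "n = n' + 4 ^ k"
    using assms(2) n' by (simp add: k)
  obtain dec :: "nat \<Rightarrow> gf4" where "bij_betw dec {0..<4} UNIV"
    using ex_bij_betw_nat_finite[of "UNIV :: gf4 set"] by (auto simp: card_gf4)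
  then interpret field_alphabet 4 dec
    by unfold_locales
  obtain e :: "nat \<Rightarrow> gf4 poly" where e: "bij_betw e {..<4 ^ k} (labels k)"
    by (rule enumerate_labels)
  define G where "G = extend n' k e F"
  have G: "code_partition n m 4 G"
    unfolding G_def n k by (rule code_partition_extend[OF F e])
  then have code: "code3 n (4 ^ (n - m)) 4 (fibre n 4 G u)" if "u \<in> labels m" for u
    using that by (simp add: code_partition_def)
  let ?P = "fibre n 4 G ` labels m"
  have "fibre n 4 G u \<noteq> {}" if "u \<in> labels m" for u
    using code[OF that] by (auto simp: code3_def)
  then have "partition_on (words n 4) ?P"
    using G by (intro partition_onI) (auto simp: fibre_def code_partition_def disjnt_iff)
  moreover have "\<not> shortened_one_perfect n 4 (fibre n 4 G 0)"
  proof
    \<comment> \<open>Shortening over four letters gives \<open>4 - 1 = 3\<close> colours.\<close>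
    assume "shortened_one_perfect n 4 (fibre n 4 G 0)"
    then obtain \<chi> K where "card K = 3" "hole_colouring n 4 {0} G \<chi> K"
      using shortened_hole_colouring by fastforce
    then show False
      using hole_colouring_extend[OF F e] col unfolding G_def n by blast
  qed
  ultimately show ?thesis
    using code code3_is_code labels_closed(1)
    by (intro exI[of _ "fibre n 4 G 0"] conjI exI[of _ ?P]) auto
qed

end
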